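(* Consider a two-player bilinear game with $f_1(x_1,x_2)=x_1^\top Ax_2$, $f_2(x_1,x_2)=x_1^\top B^\top x_2$, $A\in\mathbb{R}^{n_1\times n_2}$, $B\in\mathbb{R}^{n_2\times n_1}$, step sizes $\gamma_1,\gamma_2>0$, and let $W$ be either $W_s$ (simultaneous gradient play) or $W_a$ (alternating gradient play) as defined in the context. Write $a_{pq}$, $b_{pq}$ for the $(p,q)$ entries of $A$, $B$. (1) If coordinate $x_{2,j}$ is disturbance decoupled from coordinate $x_{1,i}$, then $b_{ji}=0$ and $\sum_{q=1}^{n_2}b_{qi}\sum_{\ell=1}^{n_1}a_{\ell q}b_{j\ell}=0$. (2) If coordinate $x_{1,j}$ is disturbance decoupled from coordinate $x_{2,i}$, then $a_{ji}=0$ and $\sum_{q=1}^{n_1}a_{qi}\sum_{\ell=1}^{n_2}b_{\ell q}a_{j\ell}=0$.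
   Context: Player 1 has action $x_1=(x_{1,1},\ldots,x_{1,n_1})\in\mathbb{R}^{n_1}$, player 2 has $x_2=(x_{2,1},\ldots,x_{2,n_2})\in\mathbb{R}^{n_2}$; the joint vector $x=(x_1,x_2)\in\mathbb{R}^{n_1+n_2}$. Simultaneous gradient play $x_1^{k+1}=x_1^k-\gamma_1Ax_2^k$, $x_2^{k+1}=x_2^k-\gamma_2Bx_1^k$ is the linear iteration $x^{k+1}=W_sx^k$ with $W_s=\begin{bmatrix}I&-\gamma_1A\\-\gamma_2B&I\end{bmatrix}$. Alternating gradient play $x_1^{k+1}=x_1^k-\gamma_1Ax_2^k$, $x_2^{k+1}=x_2^k-\gamma_2Bx_1^{k+1}$ is the linear iteration $x^{k+1}=W_ax^k$ with $W_a=\begin{bmatrix}I&-\gamma_1A\\-\gamma_2B&I+\gamma_1\gamma_2BA\end{bmatrix}$. Each coordinate is treated as a separate scalar player whose game-graph matrix is $W$. For coordinates $p\neq q$ of $\mathbb{R}^{n_1+n_2}$, with $\gamma_{(q)}$ the step size of the player owning coordinate $q$, coordinate $p$ is disturbance decoupled from coordinate $q$ if for every initial $x^0$ and every real sequence $(\delta^k)_{k\ge0}$, the iterations $x^{k+1}=Wx^k$ and $y^{k+1}=Wy^k-\gamma_{(q)}\delta^ke_q$ with $y^0=x^0$ satisfy $y^k_p=x^k_p$ for all $k\ge0$ ($e_q$ the $q$-th standard basis vector). *)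

theory Defs
  imports "HOL-Analysis.Analysis"
begin

text \<open>Joint action vector in R^(n1+n2): index type 'n1 + 'n2; coordinate x_{1,i} is
  index Inl i, coordinate x_{2,j} is index Inr j.
  A is n1 x n2 (real^'n2^'n1), B is n2 x n1 (real^'n1^'n2).\<close>

definition W_sim :: "real \<Rightarrow> real \<Rightarrow> real^'n2^'n1 \<Rightarrow> real^'n1^'n2
    \<Rightarrow> real^('n1::finite + 'n2::finite)^('n1 + 'n2)" where
  "W_sim \<gamma>1 \<gamma>2 A B = (\<chi> p q. case p of
      Inl i \<Rightarrow> (case q of Inl k \<Rightarrow> (if i = k then 1 else 0) | Inr l \<Rightarrow> - \<gamma>1 * A $ i $ l)
    | Inr j \<Rightarrow> (case q of Inl k \<Rightarrow> - \<gamma>2 * B $ j $ k | Inr l \<Rightarrow> (if j = l then 1 else 0)))"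

definition W_alt :: "real \<Rightarrow> real \<Rightarrow> real^'n2^'n1 \<Rightarrow> real^'n1^'n2
    \<Rightarrow> real^('n1::finite + 'n2::finite)^('n1 + 'n2)" where
  "W_alt \<gamma>1 \<gamma>2 A B = (\<chi> p q. case p of
      Inl i \<Rightarrow> (case q of Inl k \<Rightarrow> (if i = k then 1 else 0) | Inr l \<Rightarrow> - \<gamma>1 * A $ i $ l)
    | Inr j \<Rightarrow> (case q of Inl k \<Rightarrow> - \<gamma>2 * B $ j $ k
                       | Inr l \<Rightarrow> (if j = l then 1 else 0) + \<gamma>1 * \<gamma>2 * (B ** A) $ j $ l))"

text \<open>Step size of the player owning coordinate q.\<close>
definition step_of :: "real \<Rightarrow> real \<Rightarrow> ('n1 + 'n2) \<Rightarrow> real" where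
  "step_of \<gamma>1 \<gamma>2 q = (case q of Inl _ \<Rightarrow> \<gamma>1 | Inr _ \<Rightarrow> \<gamma>2)"

text \<open>Undisturbed iteration x^{k+1} = W x^k.\<close>
primrec lin_iter :: "real^'m^'m \<Rightarrow> real^'m \<Rightarrow> nat \<Rightarrow> real^'m" where
  "lin_iter W x0 0 = x0"
| "lin_iter W x0 (Suc k) = W *v lin_iter W x0 k"

text \<open>Disturbed iteration y^{k+1} = W y^k - c * delta^k * e_q.\<close>
primrec dist_iter :: "real^'m^'m \<Rightarrow> real \<Rightarrow> 'm \<Rightarrow> (nat \<Rightarrow> real) \<Rightarrow> real^'m \<Rightarrow> nat \<Rightarrow> real^'m" where
  "dist_iter W c q \<delta> x0 0 = x0"
| "dist_iter W c q \<delta> x0 (Suc k) = W *v dist_iter W c q \<delta> x0 k - (c * \<delta> k) *\<^sub>R axis q 1"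

text \<open>Coordinate p is disturbance decoupled from coordinate q (disturbance gain c = step size of q's owner).\<close>
definition dist_decoupled :: "real^'m^'m \<Rightarrow> real \<Rightarrow> 'm \<Rightarrow> 'm \<Rightarrow> bool" where
  "dist_decoupled W c p q \<longleftrightarrow>
     (\<forall>x0 \<delta> k. dist_iter W c q \<delta> x0 k $ p = lin_iter W x0 k $ p)"

end

theory Submission
  imports Defs
begin

text \<open>Feeding a unit impulse into coordinate q at time 0, starting from rest, shows that
  disturbance decoupling of p from q forces the entries (W^k)_pq to vanish for all k.
  For both gradient-play matrices the response from x_1,i to x_2,j is -\<gamma>2 b_ji after one
  step, and after three (simultaneous) resp. two (alternating) steps it is a multiple of b_ji
  minus \<gamma>1 \<gamma>2^2 (BAB)_ji; symmetrically with A and B exchanged. Nonzero step sizes then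
  force both entries to vanish.\<close>

definition vec_join :: "'a ^ 'm \<Rightarrow> 'a ^ 'n \<Rightarrow> 'a ^ ('m::finite + 'n::finite)" where
  "vec_join x y = (\<chi> p. case p of Inl k \<Rightarrow> x $ k | Inr l \<Rightarrow> y $ l)"

lemma vec_join_nth [simp]:
  "vec_join x y $ Inl k = x $ k"
  "vec_join x y $ Inr l = y $ l"
  by (simp_all add: vec_join_def)

lemma vec_eq_Plus_iff:
  "u = v \<longleftrightarrow> (\<forall>k. u $ Inl k = v $ Inl k) \<and> (\<forall>l. u $ Inr l = v $ Inr l)"
  by (simp add: vec_eq_iff split_sum_all)

lemma axis_Inl_eq_vec_join: "axis (Inl i) 1 = vec_join (axis i 1) (0 :: real ^ 'n::finite)"
  by (simp add: vec_eq_Plus_iff axis_def)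

lemma axis_Inr_eq_vec_join: "axis (Inr i) 1 = vec_join (0 :: real ^ 'm::finite) (axis i 1)"
  by (simp add: vec_eq_Plus_iff axis_def)

lemma sum_UNIV_Plus:
  "(\<Sum>r\<in>UNIV. f r) = (\<Sum>k\<in>UNIV. f (Inl k)) + (\<Sum>l\<in>UNIV. f (Inr l))"
  for f :: "'m::finite + 'n::finite \<Rightarrow> 'a::comm_monoid_add"
  by (simp add: UNIV_Plus_UNIV[symmetric] sum.Plus comp_def del: UNIV_Plus_UNIV)

lemma W_sim_mult_vec_join:
  "W_sim \<gamma>1 \<gamma>2 A B *v vec_join x y
     = vec_join (x - \<gamma>1 *\<^sub>R (A *v y)) (y - \<gamma>2 *\<^sub>R (B *v x))"
  by (simp add: vec_eq_Plus_iff W_sim_def matrix_vector_mult_def sum_UNIV_Plus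
      sum_distrib_left sum_negf mult.assoc if_distrib if_distribR cong: if_cong)

lemma W_alt_mult_vec_join:
  "W_alt \<gamma>1 \<gamma>2 A B *v vec_join x y
     = vec_join (x - \<gamma>1 *\<^sub>R (A *v y))
         (y - \<gamma>2 *\<^sub>R (B *v x) + (\<gamma>1 * \<gamma>2) *\<^sub>R ((B ** A) *v y))"
  by (simp add: vec_eq_Plus_iff W_alt_def matrix_vector_mult_def sum_UNIV_Plus distrib_right
      sum.distrib,
      simp add: sum_distrib_left sum_negf mult.assoc if_distrib if_distribR cong: if_cong)

lemma matrix_vector_mult_uminus_right [simp]: "M *v (- x) = - (M *v x)"
  for M :: "'a::ring_1 ^ 'n ^ 'm"
  by (simp add: vec_eq_iff matrix_vector_mult_def sum_negf)

lemma dist_decoupled_impulse_response: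
  fixes W :: "real ^ 'm ^ 'm"
  assumes "dist_decoupled W c p q" and "c \<noteq> 0"
  shows "(((*v) W ^^ k) (axis q 1)) $ p = 0"
proof -
  define impulse :: "nat \<Rightarrow> real" where "impulse m = (if m = 0 then 1 else 0)" for m
  have "lin_iter W 0 k = 0" for k
    by (induction k) auto
  moreover have "dist_iter W c q impulse 0 (Suc k) = (- c) *\<^sub>R ((*v) W ^^ k) (axis q 1)" for k
    by (induction k) (simp_all add: impulse_def matrix_vector_mult_scaleR)
  ultimately have "((- c) *\<^sub>R ((*v) W ^^ k) (axis q 1)) $ p = 0"
    using assms(1) unfolding dist_decoupled_def by (metis zero_index)
  then show ?thesis
    using assms(2) by simp
qed

lemma matrix_vector_mult_axis_nth: "(M *v axis i 1) $ j = M $ j $ i"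
  for M :: "'a::semiring_1 ^ 'n ^ 'm"
  by (simp add: matrix_vector_mult_def axis_def if_distrib cong: if_cong)

lemma W_sim_impulse_response:
  fixes A :: "real ^ 'n2::finite ^ 'n1::finite" and B :: "real ^ 'n1 ^ 'n2" and \<gamma>1 \<gamma>2 :: real
  defines "W \<equiv> W_sim \<gamma>1 \<gamma>2 A B"
  shows "(W *v axis (Inl i) 1) $ Inr j = - \<gamma>2 * B $ j $ i"
    and "(((*v) W ^^ 3) (axis (Inl i) 1)) $ Inr j
           = - 3 * \<gamma>2 * B $ j $ i - \<gamma>1 * \<gamma>2\<^sup>2 * (B ** A ** B) $ j $ i"
    and "(W *v axis (Inr j) 1) $ Inl i = - \<gamma>1 * A $ i $ j"
    and "(((*v) W ^^ 3) (axis (Inr j) 1)) $ Inl i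
           = - 3 * \<gamma>1 * A $ i $ j - \<gamma>1\<^sup>2 * \<gamma>2 * (A ** B ** A) $ i $ j"
  by (simp_all add: W_def numeral_eq_Suc axis_Inl_eq_vec_join axis_Inr_eq_vec_join
      W_sim_mult_vec_join matrix_vector_mult_axis_nth algebra_simps matrix_vector_mul_assoc
      matrix_mul_assoc power2_eq_square)

lemma W_alt_impulse_response:
  fixes A :: "real ^ 'n2::finite ^ 'n1::finite" and B :: "real ^ 'n1 ^ 'n2" and \<gamma>1 \<gamma>2 :: real
  defines "W \<equiv> W_alt \<gamma>1 \<gamma>2 A B"
  shows "(W *v axis (Inl i) 1) $ Inr j = - \<gamma>2 * B $ j $ i"
    and "(((*v) W ^^ 2) (axis (Inl i) 1)) $ Inr j
           = - 2 * \<gamma>2 * B $ j $ i - \<gamma>1 * \<gamma>2\<^sup>2 * (B ** A ** B) $ j $ i"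
    and "(W *v axis (Inr j) 1) $ Inl i = - \<gamma>1 * A $ i $ j"
    and "(((*v) W ^^ 2) (axis (Inr j) 1)) $ Inl i
           = - 2 * \<gamma>1 * A $ i $ j - \<gamma>1\<^sup>2 * \<gamma>2 * (A ** B ** A) $ i $ j"
  by (simp_all add: W_def numeral_eq_Suc axis_Inl_eq_vec_join axis_Inr_eq_vec_join
      W_alt_mult_vec_join matrix_vector_mult_axis_nth algebra_simps matrix_vector_mul_assoc
      matrix_mul_assoc power2_eq_square)

lemma gradient_play_decoupled_Inr_from_Inl:
  fixes A :: "real ^ 'n2::finite ^ 'n1::finite" and B :: "real ^ 'n1 ^ 'n2"
  assumes "W = W_sim \<gamma>1 \<gamma>2 A B \<or> W = W_alt \<gamma>1 \<gamma>2 A B"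
    and "dist_decoupled W c (Inr j) (Inl i)" and "c \<noteq> 0" and "\<gamma>1 \<noteq> 0" and "\<gamma>2 \<noteq> 0"
  shows "B $ j $ i = 0 \<and> (B ** A ** B) $ j $ i = 0"
proof -
  have response: "(((*v) W ^^ k) (axis (Inl i) 1)) $ Inr j = 0" for k
    using assms(2,3) by (rule dist_decoupled_impulse_response)
  from assms(1) show ?thesis
  proof
    assume "W = W_sim \<gamma>1 \<gamma>2 A B"
    then show ?thesis
      using response[of 1] response[of 3] assms(4,5) by (simp add: W_sim_impulse_response)
  next
    assume "W = W_alt \<gamma>1 \<gamma>2 A B"
    then show ?thesis
      using response[of 1] response[of 2] assms(4,5) by (simp add: W_alt_impulse_response)
  qed
qed

lemma gradient_play_decoupled_Inl_from_Inr:
  fixes A :: "real ^ 'n2::finite ^ 'n1::finite" and B :: "real ^ 'n1 ^ 'n2"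
  assumes "W = W_sim \<gamma>1 \<gamma>2 A B \<or> W = W_alt \<gamma>1 \<gamma>2 A B"
    and "dist_decoupled W c (Inl i) (Inr j)" and "c \<noteq> 0" and "\<gamma>1 \<noteq> 0" and "\<gamma>2 \<noteq> 0"
  shows "A $ i $ j = 0 \<and> (A ** B ** A) $ i $ j = 0"
proof -
  have response: "(((*v) W ^^ k) (axis (Inr j) 1)) $ Inl i = 0" for k
    using assms(2,3) by (rule dist_decoupled_impulse_response)
  from assms(1) show ?thesis
  proof
    assume "W = W_sim \<gamma>1 \<gamma>2 A B"
    then show ?thesis
      using response[of 1] response[of 3] assms(4,5) by (simp add: W_sim_impulse_response)
  next
    assume "W = W_alt \<gamma>1 \<gamma>2 A B"
    then show ?thesis
      using response[of 1] response[of 2] assms(4,5) by (simp add: W_alt_impulse_response)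
  qed
qed

lemma matrix_mult_triple_nth:
  "(M ** N ** P) $ j $ i = (\<Sum>q\<in>UNIV. P $ q $ i * (\<Sum>l\<in>UNIV. N $ l $ q * M $ j $ l))"
  for M :: "'a::comm_semiring_1 ^ 'n ^ 'm"
  by (simp add: matrix_matrix_mult_def sum_distrib_left sum_distrib_right mult_ac)

theorem corollary4:
  fixes A :: "real^'n2::finite^'n1::finite" and B :: "real^'n1^'n2"
    and \<gamma>1 \<gamma>2 :: real and W :: "real^('n1 + 'n2)^('n1 + 'n2)"
  assumes "\<gamma>1 > 0" and "\<gamma>2 > 0"
    and "W = W_sim \<gamma>1 \<gamma>2 A B \<or> W = W_alt \<gamma>1 \<gamma>2 A B"
  shows "(\<forall>i j. dist_decoupled W (step_of \<gamma>1 \<gamma>2 (Inl i)) (Inr j) (Inl i) \<longrightarrow>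
             B $ j $ i = 0 \<and> (\<Sum>q\<in>UNIV. B $ q $ i * (\<Sum>l\<in>UNIV. A $ l $ q * B $ j $ l)) = 0)
       \<and> (\<forall>i j. dist_decoupled W (step_of \<gamma>1 \<gamma>2 (Inr i)) (Inl j) (Inr i) \<longrightarrow>
             A $ j $ i = 0 \<and> (\<Sum>q\<in>UNIV. A $ q $ i * (\<Sum>l\<in>UNIV. B $ l $ q * A $ j $ l)) = 0)"
  using gradient_play_decoupled_Inr_from_Inl[OF assms(3)]
    gradient_play_decoupled_Inl_from_Inr[OF assms(3)] assms(1,2)
  by (simp add: step_of_def matrix_mult_triple_nth)

end
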